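(* Let $G$ be a finite non-cyclic group. Then the enhanced power graph $\mathcal{P}_E(G)$ is minimally edge connected if and only if for all distinct maximal cyclic subgroups $M_i, M_j \in \mathcal{M}(G)$ we have $|M_i|=|M_j|$ and $M_i\cap M_j=\{e\}$, where $e$ is the identity of $G$.
   Context: The enhanced power graph $\mathcal{P}_E(G)$ of a group $G$ is the simple undirected graph with vertex set $G$ in which two distinct vertices $x,y$ are adjacent if $x,y\in\langle z\rangle$ for some $z\in G$. A maximal cyclic subgroup of $G$ is a cyclic subgroup not properly contained in any cyclic subgroup of $G$; $\mathcal{M}(G)$ is the set of all maximal cyclic subgroups of $G$. The edge connectivity $\kappa'(\Gamma)$ of a graph $\Gamma$ is the minimum size of a set $S$ of edges such that $\Gamma - S$ is disconnected or has only one vertex (so $\kappa'(\Gamma)=0$ if $\Gamma$ is already disconnected or has one vertex). $\Gamma$ is minimally edge connected if $\kappa'(\Gamma-\epsilon)=\kappa'(\Gamma)-1$ for every edge $\epsilon$ of $\Gamma$. *)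

theory Defs
  imports
    "HOL-Algebra.Elementary_Groups"
    "Graph_Theory.Pair_Digraph"
    "Graph_Theory.Digraph_Component"
begin

text \<open>
  Finite simple undirected graphs are represented as in \<^locale>\<open>pair_graph\<close>: symmetric,
  loop-free pair digraphs. An undirected edge is a two-element set of vertices and
  corresponds to two opposite arcs, so deleting it removes both arcs and it is
  counted once.
\<close>

definition edges :: "'a pair_pre_digraph \<Rightarrow> 'a set set" where
  "edges \<Gamma> = {{u, v} | u v. (u, v) \<in> parcs \<Gamma>}"

definition delete_edges :: "'a pair_pre_digraph \<Rightarrow> 'a set set \<Rightarrow> 'a pair_pre_digraph" where
  "delete_edges \<Gamma> S = \<Gamma>\<lparr>parcs := {(u, v) \<in> parcs \<Gamma>. {u, v} \<notin> S}\<rparr>"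

definition edge_connectivity :: "'a pair_pre_digraph \<Rightarrow> nat" where
  "edge_connectivity \<Gamma> =
     (LEAST k. \<exists>S. S \<subseteq> edges \<Gamma> \<and> finite S \<and> card S = k \<and>
        (\<not> connected (with_proj (delete_edges \<Gamma> S)) \<or>
         card (pverts (delete_edges \<Gamma> S)) = 1))"

text \<open>
  The equation is stated over the integers: with truncated subtraction on the naturals, a
  disconnected graph would count as minimally edge connected.
\<close>

definition minimally_edge_connected :: "'a pair_pre_digraph \<Rightarrow> bool" where
  "minimally_edge_connected \<Gamma> \<longleftrightarrow>
     (\<forall>\<epsilon>\<in>edges \<Gamma>.
        int (edge_connectivity (delete_edges \<Gamma> {\<epsilon>})) = int (edge_connectivity \<Gamma>) - 1)"

definition enhanced_power_graph :: "('a, 'b) monoid_scheme \<Rightarrow> 'a pair_pre_digraph" where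
  "enhanced_power_graph G =
     \<lparr>pverts = carrier G,
      parcs = {(x, y). x \<in> carrier G \<and> y \<in> carrier G \<and> x \<noteq> y \<and>
        (\<exists>z\<in>carrier G. x \<in> generate G {z} \<and> y \<in> generate G {z})}\<rparr>"

definition cyclic_subgroup :: "'a set \<Rightarrow> ('a, 'b) monoid_scheme \<Rightarrow> bool" where
  "cyclic_subgroup H G \<longleftrightarrow> subgroup H G \<and> cyclic_group (G\<lparr>carrier := H\<rparr>)"

definition maximal_cyclic_subgroups :: "('a, 'b) monoid_scheme \<Rightarrow> 'a set set" where
  "maximal_cyclic_subgroups G =
     {M. cyclic_subgroup M G \<and> \<not> (\<exists>C. cyclic_subgroup C G \<and> M \<subset> C)}"

lemma pair_graph_enhanced_power_graph:
  assumes "finite (carrier G)"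
  shows "pair_graph (enhanced_power_graph G)"
proof -
  have "parcs (enhanced_power_graph G) \<subseteq> carrier G \<times> carrier G"
    by (auto simp: enhanced_power_graph_def)
  then have "finite (parcs (enhanced_power_graph G))"
    using assms finite_subset by blast
  then show ?thesis
    using assms
    by unfold_locales
      (auto simp: enhanced_power_graph_def symmetric_def intro!: symI)
qed

lemma (in group) cyclic_subgroup_iff_generate:
  "cyclic_subgroup H G \<longleftrightarrow> (\<exists>x\<in>carrier G. H = generate G {x})"
proof
  assume *: "cyclic_subgroup H G"
  then obtain x where x: "x \<in> H" "subgroup_generated (G\<lparr>carrier := H\<rparr>) {x} = G\<lparr>carrier := H\<rparr>"
    by (auto simp: cyclic_subgroup_def cyclic_group_def)
  then have "generate (G\<lparr>carrier := H\<rparr>) {x} = H"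
    by (metis carrier_subgroup_generated Int_insert_right_if1 inf_bot_right
        partial_object.select_convs(1) partial_object.surjective partial_object.update_convs(1))
  with x * show "\<exists>x\<in>carrier G. H = generate G {x}"
    using generate_consistent[of "{x}" H] subgroup.mem_carrier[of H G x]
    by (auto simp: cyclic_subgroup_def)
next
  assume "\<exists>x\<in>carrier G. H = generate G {x}"
  then obtain x where x: "x \<in> carrier G" "H = generate G {x}" by blast
  then have sub: "subgroup H G" and xH: "x \<in> H"
    by (auto intro: generate_is_subgroup generate.incl)
  then have "generate (G\<lparr>carrier := H\<rparr>) {x} = H"
    using generate_consistent[of "{x}" H] x by simp
  with sub xH show "cyclic_subgroup H G"
    by (auto simp: cyclic_subgroup_def cyclic_group_def subgroup_generated_def intro!: bexI[of _ x])
qed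

end

theory Submission
  imports Defs
begin

text \<open>
  The identity is adjacent to every other vertex. If \<open>X\<close> is a set of non-identity vertices and
  \<open>x \<in> X\<close>, then every neighbour \<open>y\<close> of \<open>x\<close> yields its own edge leaving \<open>X\<close>: the edge
  \<open>{x, y}\<close> if \<open>y \<notin> X\<close>, and the edge from \<open>y\<close> to the identity otherwise. So every edge cut has at
  least \<open>deg x\<close> edges, and the edge connectivity is the least degree \<open>\<delta>\<close> of a non-identity vertex.
  Deleting the edge joining the identity to \<open>v\<close> lowers the edge connectivity only if some cut with
  \<open>\<delta>\<close> edges separates the two, which forces \<open>deg v = \<delta>\<close>; hence the graph is minimally edge
  connected iff all non-identity vertices have the same degree. Finally, the closed neighbourhood
  of \<open>x\<close> is the union of the maximal cyclic subgroups containing \<open>x\<close>, and it is a single one of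
  them if \<open>x\<close> is a generator of it.
\<close>

section \<open>Edge connectivity of graphs with a dominating vertex\<close>

text \<open>Edges are two-element sets, so that a cut can be compared with the sets removed by
  \<open>delete_edges\<close>; looking only at arcs out of \<open>X\<close> loses nothing in a
  symmetric graph.\<close>

definition edge_cut :: "'a pair_pre_digraph \<Rightarrow> 'a set \<Rightarrow> 'a set set" where
  "edge_cut \<Gamma> X = {{u, v} | u v. (u, v) \<in> parcs \<Gamma> \<and> u \<in> X \<and> v \<notin> X}"

definition degree :: "'a pair_pre_digraph \<Rightarrow> 'a \<Rightarrow> nat" where
  "degree \<Gamma> v = card (parcs \<Gamma> `` {v})"

lemma edge_cut_subset_edges: "edge_cut \<Gamma> X \<subseteq> edges \<Gamma>"
  by (auto simp: edge_cut_def edges_def)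

lemma pverts_delete_edges [simp]: "pverts (delete_edges \<Gamma> S) = pverts \<Gamma>"
  by (simp add: delete_edges_def)

lemma parcs_delete_edges: "parcs (delete_edges \<Gamma> S) = {(u, v) \<in> parcs \<Gamma>. {u, v} \<notin> S}"
  by (simp add: delete_edges_def)

lemma delete_edges_empty [simp]: "delete_edges \<Gamma> {} = \<Gamma>"
  by (simp add: delete_edges_def)

lemma delete_edges_delete_edges: "delete_edges (delete_edges \<Gamma> S) T = delete_edges \<Gamma> (S \<union> T)"
  by (auto simp: delete_edges_def intro!: arg_cong[where f = "\<lambda>A. \<Gamma>\<lparr>parcs := A\<rparr>"])

lemma edges_delete_edges: "edges (delete_edges \<Gamma> S) = edges \<Gamma> - S"
  by (auto simp: edges_def parcs_delete_edges)

lemma edge_cut_singleton_eq: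
  assumes "(v, v) \<notin> parcs \<Gamma>"
  shows "edge_cut \<Gamma> {v} = (\<lambda>y. {v, y}) ` (parcs \<Gamma> `` {v})"
  using assms by (auto simp: edge_cut_def)

lemma card_edge_cut_singleton:
  assumes "(v, v) \<notin> parcs \<Gamma>"
  shows "card (edge_cut \<Gamma> {v}) = degree \<Gamma> v"
proof -
  have "inj_on (\<lambda>y. {v, y}) (parcs \<Gamma> `` {v})"
    by (auto simp: inj_on_def doubleton_eq_iff)
  then show ?thesis
    by (simp add: edge_cut_singleton_eq[OF assms] degree_def card_image)
qed

section \<open>Disconnecting edge sets and edge cuts\<close>

context pair_graph
begin

lemma parcs_sym: "(u, v) \<in> parcs G \<Longrightarrow> (v, u) \<in> parcs G"
  using sym_arcs by (auto simp: symmetric_def elim: symE)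

lemma finite_edges: "finite (edges G)"
proof -
  have "edges G = (\<lambda>(u, v). {u, v}) ` parcs G"
    by (auto simp: edges_def)
  then show ?thesis by simp
qed

lemma connected_iff_strongly_connected:
  "connected (with_proj G) \<longleftrightarrow> strongly_connected (with_proj G)"
  using reachable_mk_symmetric_eq[OF sym_arcs]
  by (auto simp: connected_def strongly_connected_def)

text \<open>No edge leaves the set of vertices unreachable from \<open>c\<close>. Keeping
  \<open>c\<close> outside \<open>X\<close> costs no generality; once \<open>c\<close> is
  dominating, it gives every vertex of \<open>X\<close> a neighbour outside
  \<open>X\<close>.\<close>

lemma not_connected_iff:
  assumes "c \<in> pverts G"
  shows "\<not> connected (with_proj G) \<longleftrightarrow>
    (\<exists>X. X \<noteq> {} \<and> X \<subseteq> pverts G - {c} \<and> edge_cut G X = {})"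
proof
  assume "\<not> connected (with_proj G)"
  then obtain u v where uv: "u \<in> pverts G" "v \<in> pverts G" "\<not> u \<rightarrow>\<^sup>*\<^bsub>with_proj G\<^esub> v"
    using assms by (auto simp: connected_iff_strongly_connected strongly_connected_def)
  define X where "X = {w \<in> pverts G. \<not> c \<rightarrow>\<^sup>*\<^bsub>with_proj G\<^esub> w}"
  \<comment> \<open>If \<open>c\<close> reached both \<open>u\<close> and \<open>v\<close>, then by
    symmetry \<open>u\<close> would reach \<open>v\<close> through \<open>c\<close>.\<close>
  have "X \<noteq> {}"
    using uv by (auto simp: X_def dest: symmetric_reachable[OF sym_arcs] intro: reachable_trans)
  moreover have "X \<subseteq> pverts G - {c}"
    using assms by (auto simp: X_def)
  moreover have False if "(u, v) \<in> parcs G" "u \<in> X" "v \<notin> X" for u v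
  proof -
    have "c \<rightarrow>\<^sup>*\<^bsub>with_proj G\<^esub> v"
      using that in_arcsD2 by (auto simp: X_def)
    then have "c \<rightarrow>\<^sup>*\<^bsub>with_proj G\<^esub> u"
      using parcs_sym[OF that(1)] reachable_adj_trans by blast
    with that show False by (simp add: X_def)
  qed
  then have "edge_cut G X = {}"
    by (auto simp: edge_cut_def)
  ultimately show "\<exists>X. X \<noteq> {} \<and> X \<subseteq> pverts G - {c} \<and> edge_cut G X = {}" by blast
next
  assume "\<exists>X. X \<noteq> {} \<and> X \<subseteq> pverts G - {c} \<and> edge_cut G X = {}"
  then obtain X x where X: "x \<in> X" "X \<subseteq> pverts G - {c}" "edge_cut G X = {}" by blast
  show "\<not> connected (with_proj G)"
  proof
    assume "connected (with_proj G)"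
    then have "x \<rightarrow>\<^sup>*\<^bsub>with_proj G\<^esub> c"
      using X assms by (auto simp: connected_iff_strongly_connected strongly_connected_def)
    \<comment> \<open>A walk starting in \<open>X\<close> stays in \<open>X\<close>, since no arc
      leaves it.\<close>
    then have "c \<in> X"
    proof (induction rule: reachable_induct)
      case base
      then show ?case using X by simp
    next
      case (step y z)
      then show ?case using X(3) by (auto simp: edge_cut_def)
    qed
    with X show False by blast
  qed
qed

lemma pair_graph_delete_edges: "pair_graph (delete_edges G S)"
proof -
  have "parcs (delete_edges G S) \<subseteq> parcs G"
    by (auto simp: parcs_delete_edges)
  then have "finite (parcs (delete_edges G S))"
    by (rule finite_subset) simp
  then show ?thesis
    using in_arcsD1 in_arcsD2 finite_verts no_loops parcs_sym
    by unfold_locales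
      (auto simp: parcs_delete_edges symmetric_def insert_commute intro!: symI)
qed

text \<open>No edge leaves \<open>X\<close> after the deletion exactly when the original cut of
  \<open>X\<close> was deleted entirely, so all counting can be done in the original graph.\<close>

lemma not_connected_delete_edges_iff:
  assumes "c \<in> pverts G"
  shows "\<not> connected (with_proj (delete_edges G S)) \<longleftrightarrow>
    (\<exists>X. X \<noteq> {} \<and> X \<subseteq> pverts G - {c} \<and> edge_cut G X \<subseteq> S)"
proof -
  have "edge_cut (delete_edges G S) X = {} \<longleftrightarrow> edge_cut G X \<subseteq> S" for X
    by (auto simp: edge_cut_def parcs_delete_edges)
  then show ?thesis
    using pair_graph.not_connected_iff[OF pair_graph_delete_edges, of c S] assms by simp
qed

end

text \<open>\<open>ex_other\<close> excludes the one-vertex graph, whose edge connectivity is 0 by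
  convention, and keeps the minimum in \<open>min_degree\<close> from ranging over the empty
  set.\<close>

locale dominated_graph = pair_graph G for G :: "'a pair_pre_digraph" +
  fixes c :: 'a
  assumes c_in_pverts: "c \<in> pverts G"
    and dominating: "v \<in> pverts G \<Longrightarrow> v \<noteq> c \<Longrightarrow> (c, v) \<in> parcs G"
    and ex_other: "\<exists>v\<in>pverts G. v \<noteq> c"
begin

section \<open>Least degree and the size of edge cuts\<close>

abbreviation others :: "'a set" where
  "others \<equiv> pverts G - {c}"

text \<open>The vertex \<open>c\<close> has the largest degree, so this is the minimum degree of the
  whole graph.\<close>

definition min_degree :: nat where
  "min_degree = Min (degree G ` others)"

lemma finite_others: "finite others"
  using finite_verts by simp

lemma min_degree_le: "v \<in> others \<Longrightarrow> min_degree \<le> degree G v"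
  using finite_others by (simp add: min_degree_def)

lemma ex_min_degree: "\<exists>v\<in>others. degree G v = min_degree"
proof -
  have "min_degree \<in> degree G ` others"
    unfolding min_degree_def using finite_others ex_other by (intro Min_in) auto
  then show ?thesis by auto
qed

lemma degree_pos:
  assumes "v \<in> others"
  shows "degree G v > 0"
proof -
  have "c \<in> parcs G `` {v}"
    using dominating parcs_sym assms by blast
  moreover have "finite (parcs G `` {v})"
    using finite_arcs by (simp add: finite_Image)
  ultimately show ?thesis
    unfolding degree_def by (auto simp: card_gt_0_iff)
qed

lemma no_loop [simp]: "(v, v) \<notin> parcs G"
  using no_loops by fastforce

lemma degree_le_card_edge_cut:
  assumes X: "X \<subseteq> others" "x \<in> X"
  shows "degree G x \<le> card (edge_cut G X)"
proof -
  define f where "f y = (if y \<in> X then {y, c} else {x, y})" for y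
  have "c \<notin> X" using X by blast
  have "inj_on f (parcs G `` {x})"
  proof (rule inj_onI)
    fix y z assume *: "y \<in> parcs G `` {x}" "z \<in> parcs G `` {x}" "f y = f z"
    \<comment> \<open>Edges of the two kinds could collide only as \<open>{y, c} = {x, c}\<close>,
      which would make \<open>x\<close> its own neighbour.\<close>
    then have "y \<noteq> x" "z \<noteq> x" by auto
    with * X \<open>c \<notin> X\<close> show "y = z"
      by (auto simp: f_def doubleton_eq_iff split: if_splits)
  qed
  moreover have "f ` (parcs G `` {x}) \<subseteq> edge_cut G X"
  proof (rule image_subsetI)
    fix y assume y: "y \<in> parcs G `` {x}"
    show "f y \<in> edge_cut G X"
    proof (cases "y \<in> X")
      case True
      then have "(y, c) \<in> parcs G"
        using X dominating parcs_sym by blast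
      with True \<open>c \<notin> X\<close> show ?thesis
        by (auto simp: f_def edge_cut_def)
    next
      case False
      with y X show ?thesis
        by (auto simp: f_def edge_cut_def)
    qed
  qed
  moreover have "finite (edge_cut G X)"
    using finite_edges edge_cut_subset_edges finite_subset by blast
  ultimately show ?thesis
    unfolding degree_def by (metis card_image card_mono)
qed

text \<open>With at least two vertices the single-vertex alternative never occurs, and successive
  deletions merge into one. The general \<open>D\<close> covers both the intact graph and the graph
  with one edge removed.\<close>

lemma edge_connectivity_delete_edges:
  assumes "D \<subseteq> edges G"
  shows "edge_connectivity (delete_edges G D) =
    (LEAST k. \<exists>S. S \<subseteq> edges G - D \<and> card S = k \<and>
       \<not> connected (with_proj (delete_edges G (D \<union> S))))"
proof -
  have "card (pverts G) \<noteq> 1"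
    using c_in_pverts ex_other by (auto simp: card_1_singleton_iff)
  moreover have "finite S" if "S \<subseteq> edges G - D" for S
    using that finite_edges finite_subset by blast
  ultimately show ?thesis
    unfolding edge_connectivity_def delete_edges_delete_edges edges_delete_edges
    by (intro arg_cong[where f = Least] ext) auto
qed

lemma edge_connectivity_delete_edges_le:
  assumes "D \<subseteq> edges G" "S \<subseteq> edges G - D" "\<not> connected (with_proj (delete_edges G (D \<union> S)))"
  shows "edge_connectivity (delete_edges G D) \<le> card S"
  unfolding edge_connectivity_delete_edges[OF assms(1)]
  using assms(2,3) by (intro Least_le) blast

lemma not_connected_delete_edge_cut:
  assumes "v \<in> others" "edge_cut G {v} \<subseteq> S"
  shows "\<not> connected (with_proj (delete_edges G S))"
  using assms not_connected_delete_edges_iff[OF c_in_pverts, of S] by blast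

lemma edge_connectivity_delete_edges_attained:
  assumes "D \<subseteq> edges G"
  obtains S X where "S \<subseteq> edges G - D" "card S = edge_connectivity (delete_edges G D)"
    "X \<noteq> {}" "X \<subseteq> others" "edge_cut G X \<subseteq> D \<union> S"
proof -
  obtain v where "v \<in> others" using ex_other by blast
  \<comment> \<open>The least \<open>k\<close> exists: deleting all remaining edges isolates
    \<open>v\<close>.\<close>
  then have "\<not> connected (with_proj (delete_edges G (D \<union> (edges G - D))))"
    using edge_cut_subset_edges[of G "{v}"] by (intro not_connected_delete_edge_cut) auto
  then have "\<exists>k S. S \<subseteq> edges G - D \<and> card S = k \<and>
       \<not> connected (with_proj (delete_edges G (D \<union> S)))"
    by blast
  from LeastI_ex[OF this] obtain S where S: "S \<subseteq> edges G - D"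
      "card S = edge_connectivity (delete_edges G D)"
      "\<not> connected (with_proj (delete_edges G (D \<union> S)))"
    unfolding edge_connectivity_delete_edges[OF assms, symmetric] by (elim exE conjE)
  obtain X where "X \<noteq> {}" "X \<subseteq> others" "edge_cut G X \<subseteq> D \<union> S"
    using S(3) unfolding not_connected_delete_edges_iff[OF c_in_pverts] by (elim exE conjE)
  with S(1,2) show ?thesis by (rule that)
qed

text \<open>\<open>D\<close> and an optimal \<open>S\<close> together contain a cut, which has at
  least \<open>min_degree\<close> edges. For \<open>D = {}\<close> this is the lower bound on the
  edge connectivity; for a single edge it says that one deletion lowers it by at most one.\<close>

lemma min_degree_le_edge_connectivity_delete_edges:
  assumes "D \<subseteq> edges G"
  shows "min_degree \<le> card D + edge_connectivity (delete_edges G D)"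
proof -
  obtain S X where S: "S \<subseteq> edges G - D" "card S = edge_connectivity (delete_edges G D)"
    and X: "X \<noteq> {}" "X \<subseteq> others" "edge_cut G X \<subseteq> D \<union> S"
    by (rule edge_connectivity_delete_edges_attained[OF assms])
  obtain x where "x \<in> X" using X(1) by blast
  have fin: "finite (D \<union> S)"
    using assms S finite_edges by (meson Diff_subset Un_least finite_subset subset_trans)
  have "min_degree \<le> degree G x" using min_degree_le X(2) \<open>x \<in> X\<close> by blast
  also have "\<dots> \<le> card (edge_cut G X)" using degree_le_card_edge_cut X(2) \<open>x \<in> X\<close> by blast
  also have "\<dots> \<le> card (D \<union> S)" using card_mono[OF fin X(3)] .
  also have "\<dots> \<le> card D + card S" by (rule card_Un_le)
  finally show ?thesis using S by simp
qed

lemma edge_connectivity_eq_min_degree: "edge_connectivity G = min_degree"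
proof (rule antisym)
  \<comment> \<open>Isolating a vertex of least degree gives the upper bound.\<close>
  obtain v where v: "v \<in> others" "degree G v = min_degree"
    using ex_min_degree by blast
  then have "\<not> connected (with_proj (delete_edges G (edge_cut G {v})))"
    by (intro not_connected_delete_edge_cut) auto
  then show "edge_connectivity G \<le> min_degree"
    using edge_connectivity_delete_edges_le[of "{}" "edge_cut G {v}"] v
      edge_cut_subset_edges[of G "{v}"] card_edge_cut_singleton[of v G] by simp
  show "min_degree \<le> edge_connectivity G"
    using min_degree_le_edge_connectivity_delete_edges[of "{}"] by simp
qed

section \<open>Minimal edge connectivity as equality of degrees\<close>

lemma minimally_edge_connected_iff:
  "minimally_edge_connected G \<longleftrightarrow> (\<forall>v\<in>others. degree G v = min_degree)"
proof
  assume mec: "minimally_edge_connected G"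
  show "\<forall>v\<in>others. degree G v = min_degree"
  proof
    fix v assume v: "v \<in> others"
    let ?e = "{c, v}"
    have e: "{?e} \<subseteq> edges G"
      using v dominating by (auto simp: edges_def)
    have min_eq: "min_degree = Suc (edge_connectivity (delete_edges G {?e}))"
      using mec e edge_connectivity_eq_min_degree by (force simp: minimally_edge_connected_def)
    obtain S X where S: "S \<subseteq> edges G - {?e}" "card S = edge_connectivity (delete_edges G {?e})"
      and X: "X \<noteq> {}" "X \<subseteq> others" "edge_cut G X \<subseteq> {?e} \<union> S"
      by (rule edge_connectivity_delete_edges_attained[OF e])
    have fin: "finite S"
      using S(1) finite_edges finite_subset by blast
    \<comment> \<open>\<open>S\<close> has \<open>min_degree - 1\<close> edges and avoids
      \<open>?e\<close>.\<close>
    then have card_eS: "card ({?e} \<union> S) = min_degree"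
      using S min_eq by (subst card_Un_disjoint) auto
    have deg_le: "degree G x \<le> card (edge_cut G X)" if "x \<in> X" for x
      using that X(2) degree_le_card_edge_cut by blast
    have "min_degree \<le> card (edge_cut G X)"
      using X(1,2) min_degree_le deg_le by (meson all_not_in_conv order_trans subsetD)
    \<comment> \<open>A cut of at least \<open>min_degree\<close> edges inside a set of exactly that
      size fills it, and so contains the deleted edge.\<close>
    then have cut_eq: "edge_cut G X = {?e} \<union> S"
      using X(3) fin card_eS by (intro card_seteq) auto
    then have "?e \<in> edge_cut G X" by simp
    \<comment> \<open>An edge leaving \<open>X\<close> has one end in \<open>X\<close>, and
      \<open>c\<close> is not in \<open>X\<close>.\<close>
    then have "v \<in> X"
      using X(2) by (auto simp: edge_cut_def doubleton_eq_iff)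
    then have "degree G v \<le> min_degree"
      using deg_le cut_eq card_eS by metis
    then show "degree G v = min_degree"
      using min_degree_le[OF v] by simp
  qed
next
  assume deg: "\<forall>v\<in>others. degree G v = min_degree"
  have "int (edge_connectivity (delete_edges G {e})) = int (edge_connectivity G) - 1"
    if e: "e \<in> edges G" for e
  proof -
    \<comment> \<open>Some end \<open>v\<close> of \<open>e\<close> differs from \<open>c\<close>;
      once \<open>e\<close> is gone, deleting the other \<open>min_degree - 1\<close> edges at
      \<open>v\<close> isolates it.\<close>
    obtain v where v: "v \<in> others" "e \<in> edge_cut G {v}"
    proof -
      obtain u w where uw: "e = {u, w}" "(u, w) \<in> parcs G"
        using e by (auto simp: edges_def)
      have "u \<noteq> w" using uw by auto
      then have "e \<in> edge_cut G {u}" "e \<in> edge_cut G {w}"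
        using uw parcs_sym by (auto simp: edge_cut_def insert_commute)
      moreover have "u \<in> others \<or> w \<in> others"
        using uw \<open>u \<noteq> w\<close> in_arcsD1 in_arcsD2 by auto
      ultimately show ?thesis using that by blast
    qed
    have "\<not> connected (with_proj (delete_edges G ({e} \<union> (edge_cut G {v} - {e}))))"
      using v by (intro not_connected_delete_edge_cut) auto
    then have "edge_connectivity (delete_edges G {e}) \<le> card (edge_cut G {v} - {e})"
      using e edge_cut_subset_edges[of G "{v}"]
      by (intro edge_connectivity_delete_edges_le) auto
    also have "\<dots> = min_degree - 1"
      using v deg card_edge_cut_singleton[of v G] by simp
    finally have "edge_connectivity (delete_edges G {e}) \<le> min_degree - 1" .
    moreover have "min_degree \<le> 1 + edge_connectivity (delete_edges G {e})"
      using min_degree_le_edge_connectivity_delete_edges[of "{e}"] e by simp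
    \<comment> \<open>Positivity turns the truncated \<open>min_degree - 1\<close> into the true
      difference demanded over the integers.\<close>
    moreover have "min_degree > 0"
      using degree_pos v deg by fastforce
    ultimately show ?thesis
      using edge_connectivity_eq_min_degree by linarith
  qed
  then show "minimally_edge_connected G"
    by (simp add: minimally_edge_connected_def)
qed

corollary minimally_edge_connected_iff_regular:
  "minimally_edge_connected G \<longleftrightarrow> (\<forall>u\<in>others. \<forall>v\<in>others. degree G u = degree G v)"
  using minimally_edge_connected_iff ex_min_degree by metis

end

section \<open>Maximal cyclic subgroups\<close>

context group
begin

lemma cyclic_subgroup_subset_carrier: "cyclic_subgroup H G \<Longrightarrow> H \<subseteq> carrier G"
  by (simp add: cyclic_subgroup_def subgroup.subset)

lemma generate_singleton_subset:
  "cyclic_subgroup H G \<Longrightarrow> x \<in> H \<Longrightarrow> generate G {x} \<subseteq> H"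
  by (simp add: cyclic_subgroup_def generate_subgroup_incl)

lemma one_in_cyclic_subgroup: "cyclic_subgroup H G \<Longrightarrow> \<one> \<in> H"
  by (simp add: cyclic_subgroup_def subgroup.one_closed)

lemma cyclic_subgroup_generate: "x \<in> carrier G \<Longrightarrow> cyclic_subgroup (generate G {x}) G"
  by (auto simp: cyclic_subgroup_iff_generate)

lemma cyclic_subgroup_subset_maximal:
  assumes "finite (carrier G)" "cyclic_subgroup H G"
  obtains M where "M \<in> maximal_cyclic_subgroups G" "H \<subseteq> M"
proof -
  let ?A = "{C. cyclic_subgroup C G}"
  have "?A \<subseteq> Pow (carrier G)"
    using cyclic_subgroup_subset_carrier by blast
  then have "finite ?A"
    using assms(1) by (meson finite_Pow_iff finite_subset)
  then obtain M where "M \<in> ?A" "H \<subseteq> M" "\<forall>C\<in>?A. M \<subseteq> C \<longrightarrow> M = C"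
    using finite_has_maximal2[of ?A H] assms(2) by auto
  then show ?thesis
    by (intro that[of M]) (auto simp: maximal_cyclic_subgroups_def psubset_eq)
qed

text \<open>Take a generator: any cyclic subgroup containing it contains \<open>M\<close>, hence
  equals \<open>M\<close> by maximality.\<close>

lemma maximal_cyclic_subgroup_generator:
  assumes "M \<in> maximal_cyclic_subgroups G"
  obtains g where "g \<in> M" "\<And>N. N \<in> maximal_cyclic_subgroups G \<Longrightarrow> g \<in> N \<Longrightarrow> N = M"
proof -
  have M: "cyclic_subgroup M G" "\<not> (\<exists>C. cyclic_subgroup C G \<and> M \<subset> C)"
    using assms by (auto simp: maximal_cyclic_subgroups_def)
  then obtain g where g: "g \<in> carrier G" "M = generate G {g}"
    by (auto simp: cyclic_subgroup_iff_generate)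
  have "N = M" if "N \<in> maximal_cyclic_subgroups G" "g \<in> N" for N
    using that generate_singleton_subset[of N g] g M(2)
    by (auto simp: maximal_cyclic_subgroups_def)
  moreover have "g \<in> M"
    using g by (simp add: generate.incl)
  ultimately show ?thesis using that by blast
qed

section \<open>Degrees in the enhanced power graph\<close>

lemma enhanced_power_graph_neighbours:
  assumes "finite (carrier G)"
  shows "parcs (enhanced_power_graph G) `` {x} =
    \<Union>{M \<in> maximal_cyclic_subgroups G. x \<in> M} - {x}"
proof (intro equalityI subsetI)
  fix y assume "y \<in> parcs (enhanced_power_graph G) `` {x}"
  then obtain z where z: "z \<in> carrier G" "x \<in> generate G {z}" "y \<in> generate G {z}" "y \<noteq> x"
    by (auto simp: enhanced_power_graph_def)
  \<comment> \<open>The common cyclic subgroup witnessing adjacency can be enlarged to a maximal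
    one.\<close>
  obtain M where "M \<in> maximal_cyclic_subgroups G" "generate G {z} \<subseteq> M"
    using cyclic_subgroup_subset_maximal[OF assms cyclic_subgroup_generate[OF z(1)]] by blast
  with z show "y \<in> \<Union>{M \<in> maximal_cyclic_subgroups G. x \<in> M} - {x}" by blast
next
  fix y assume "y \<in> \<Union>{M \<in> maximal_cyclic_subgroups G. x \<in> M} - {x}"
  then obtain M where M: "cyclic_subgroup M G" "x \<in> M" "y \<in> M" "y \<noteq> x"
    by (auto simp: maximal_cyclic_subgroups_def)
  \<comment> \<open>A generator of \<open>M\<close> is the witness that adjacency asks for.\<close>
  moreover obtain z where "z \<in> carrier G" "M = generate G {z}"
    using M by (auto simp: cyclic_subgroup_iff_generate)
  ultimately show "y \<in> parcs (enhanced_power_graph G) `` {x}"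
    using cyclic_subgroup_subset_carrier[of M] by (auto simp: enhanced_power_graph_def)
qed

text \<open>\<open>Suc\<close> counts \<open>x\<close> itself, which lies in the union because
  \<open>generate G {x}\<close> extends to a maximal cyclic subgroup.\<close>

lemma Suc_degree_enhanced_power_graph:
  assumes "finite (carrier G)" "x \<in> carrier G"
  shows "Suc (degree (enhanced_power_graph G) x) =
    card (\<Union>{M \<in> maximal_cyclic_subgroups G. x \<in> M})" (is "_ = card ?U")
proof -
  obtain M where "M \<in> maximal_cyclic_subgroups G" "generate G {x} \<subseteq> M"
    using cyclic_subgroup_subset_maximal[OF assms(1) cyclic_subgroup_generate[OF assms(2)]]
    by blast
  then have "x \<in> ?U"
    using generate.incl[of x "{x}" G] by blast
  moreover have "?U \<subseteq> carrier G"
    using cyclic_subgroup_subset_carrier by (auto simp: maximal_cyclic_subgroups_def)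
  then have "finite ?U"
    using assms(1) finite_subset by blast
  ultimately show ?thesis
    unfolding degree_def enhanced_power_graph_neighbours[OF assms(1)]
    by (rule card_Suc_Diff1[rotated])
qed

text \<open>The identity and \<open>v\<close> both lie in \<open>generate G {v}\<close>.
  Non-cyclicity supplies a second vertex, the trivial group being cyclic.\<close>

lemma dominated_graph_enhanced_power_graph:
  assumes "finite (carrier G)" "\<not> cyclic_group G"
  shows "dominated_graph (enhanced_power_graph G) \<one>"
proof -
  interpret pair_graph "enhanced_power_graph G"
    using assms(1) by (rule pair_graph_enhanced_power_graph)
  have "carrier G \<noteq> {\<one>}"
    using assms(2) trivial_imp_cyclic_group by (auto simp: trivial_group_def is_group)
  then have "\<exists>v\<in>carrier G. v \<noteq> \<one>"
    by auto
  moreover have "(\<one>, v) \<in> parcs (enhanced_power_graph G)" if "v \<in> carrier G" "v \<noteq> \<one>" for v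
    using that by (auto simp: enhanced_power_graph_def intro: generate.one generate.incl)
  ultimately show ?thesis
    by unfold_locales (auto simp: enhanced_power_graph_def)
qed

lemma degrees_eq_iff_maximal_cyclic_subgroups:
  assumes fin: "finite (carrier G)"
  defines "deg \<equiv> degree (enhanced_power_graph G)"
  shows "(\<forall>x\<in>carrier G - {\<one>}. \<forall>y\<in>carrier G - {\<one>}. deg x = deg y) \<longleftrightarrow>
    (\<forall>M\<in>maximal_cyclic_subgroups G. \<forall>N\<in>maximal_cyclic_subgroups G.
       M \<noteq> N \<longrightarrow> card M = card N \<and> M \<inter> N = {\<one>})" (is "?L \<longleftrightarrow> ?R")
proof
  assume L: ?L
  show ?R
  proof (intro ballI impI)
    fix M N assume MN: "M \<in> maximal_cyclic_subgroups G" "N \<in> maximal_cyclic_subgroups G" "M \<noteq> N"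
    have cyc: "cyclic_subgroup M G" "cyclic_subgroup N G"
      using MN by (auto simp: maximal_cyclic_subgroups_def)
    \<comment> \<open>\<open>K'\<close> ensures that the generator is not the identity: the identity
      also lies in \<open>K'\<close>, whereas the generator lies in \<open>K\<close> alone.\<close>
    have generator: "\<exists>g\<in>K - {\<one>}. Suc (deg g) = card K"
      if K: "K \<in> maximal_cyclic_subgroups G" "K' \<in> maximal_cyclic_subgroups G" "K \<noteq> K'"
      for K K'
    proof -
      obtain g where g: "g \<in> K" "\<And>N. N \<in> maximal_cyclic_subgroups G \<Longrightarrow> g \<in> N \<Longrightarrow> N = K"
        using maximal_cyclic_subgroup_generator[OF K(1)] by blast
      have "{N \<in> maximal_cyclic_subgroups G. g \<in> N} = {K}"
        using g K(1) by blast
      moreover have "g \<in> carrier G"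
        using g(1) K(1) cyclic_subgroup_subset_carrier
        by (auto simp: maximal_cyclic_subgroups_def)
      ultimately have "Suc (deg g) = card K"
        using Suc_degree_enhanced_power_graph[OF fin, of g] by (simp add: deg_def)
      moreover have "g \<noteq> \<one>"
        using g(2)[of K'] K one_in_cyclic_subgroup by (auto simp: maximal_cyclic_subgroups_def)
      ultimately show ?thesis using g(1) by blast
    qed
    obtain g h where g: "g \<in> M - {\<one>}" "Suc (deg g) = card M"
      and h: "h \<in> N - {\<one>}" "Suc (deg h) = card N"
      using generator[of M N] generator[of N M] MN by blast
    have sub: "M \<subseteq> carrier G" "N \<subseteq> carrier G"
      using cyc cyclic_subgroup_subset_carrier by auto
    have deg_g: "deg x = deg g" if "x \<in> carrier G - {\<one>}" for x
      using L that g(1) sub(1) by blast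
    have "h \<in> carrier G - {\<one>}" using h(1) sub(2) by blast
    then have card_eq: "card M = card N"
      using deg_g g(2) h(2) by metis
    moreover have "x = \<one>" if x: "x \<in> M" "x \<in> N" for x
    proof (rule ccontr)
      assume "x \<noteq> \<one>"
      \<comment> \<open>The closed neighbourhood of a common \<open>x\<close> contains both
        \<open>M\<close> and \<open>N\<close> but has their common size, so both would equal
        it.\<close>
      let ?U = "\<Union>{M \<in> maximal_cyclic_subgroups G. x \<in> M}"
      have "x \<in> carrier G - {\<one>}" using x sub \<open>x \<noteq> \<one>\<close> by blast
      then have "card ?U = card M"
        using Suc_degree_enhanced_power_graph[OF fin, of x] deg_g g(2) by (simp add: deg_def)
      moreover have "finite ?U"
        using fin cyclic_subgroup_subset_carrier
        by (intro finite_subset[OF _ fin]) (auto simp: maximal_cyclic_subgroups_def)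
      moreover have "M \<subseteq> ?U" "N \<subseteq> ?U"
        using x MN by auto
      ultimately have "M = ?U" "N = ?U"
        using card_eq by (metis card_subset_eq)+
      with MN(3) show False by simp
    qed
    ultimately show "card M = card N \<and> M \<inter> N = {\<one>}"
      using one_in_cyclic_subgroup cyc by blast
  qed
next
  assume R: ?R
  have unique: "\<exists>M\<in>maximal_cyclic_subgroups G. Suc (deg x) = card M" if x: "x \<in> carrier G - {\<one>}" for x
  proof -
    obtain M where M: "M \<in> maximal_cyclic_subgroups G" "generate G {x} \<subseteq> M"
      using cyclic_subgroup_subset_maximal[OF fin cyclic_subgroup_generate] x by blast
    then have "x \<in> M"
      using generate.incl[of x "{x}" G] by blast
    \<comment> \<open>A second maximal cyclic subgroup through \<open>x\<close> would meet
      \<open>M\<close> outside the identity.\<close>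
    then have "{N \<in> maximal_cyclic_subgroups G. x \<in> N} = {M}"
      using M(1) R x by blast
    then show ?thesis
      using Suc_degree_enhanced_power_graph[OF fin, of x] x M(1) by (auto simp: deg_def)
  qed
  show ?L
  proof (intro ballI)
    fix x y assume xy: "x \<in> carrier G - {\<one>}" "y \<in> carrier G - {\<one>}"
    obtain M where M: "M \<in> maximal_cyclic_subgroups G" "Suc (deg x) = card M"
      using unique[OF xy(1)] by (elim bexE)
    obtain N where N: "N \<in> maximal_cyclic_subgroups G" "Suc (deg y) = card N"
      using unique[OF xy(2)] by (elim bexE)
    \<comment> \<open>The hypothesis speaks only of distinct subgroups, hence the case
      split.\<close>
    have "card M = card N"
      using R[rule_format, OF M(1) N(1)] by (cases "M = N") simp_all
    with M(2) N(2) show "deg x = deg y" by simp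
  qed
qed

end

theorem corollary2p3:
  fixes G :: "('a, 'b) monoid_scheme"
  assumes "group G" and "finite (carrier G)" and "\<not> cyclic_group G"
  shows "minimally_edge_connected (enhanced_power_graph G) \<longleftrightarrow>
    (\<forall>M\<^sub>i\<in>maximal_cyclic_subgroups G. \<forall>M\<^sub>j\<in>maximal_cyclic_subgroups G.
       M\<^sub>i \<noteq> M\<^sub>j \<longrightarrow> card M\<^sub>i = card M\<^sub>j \<and> M\<^sub>i \<inter> M\<^sub>j = {\<one>\<^bsub>G\<^esub>})"
proof -
  interpret group G by fact
  interpret dominated_graph "enhanced_power_graph G" "\<one>\<^bsub>G\<^esub>"
    using assms(2,3) by (rule dominated_graph_enhanced_power_graph)
  have "pverts (enhanced_power_graph G) = carrier G"
    by (simp add: enhanced_power_graph_def)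
  then show ?thesis
    using minimally_edge_connected_iff_regular
      degrees_eq_iff_maximal_cyclic_subgroups[OF assms(2)] by simp
qed

end
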